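(* Let $G$ be a finite simple connected unicyclic graph that is not a cycle, and let $m$ be the order (number of vertices) of its unique cycle $C(G)$. Then $$l(G)\leq \psi(G)\leq\begin{cases} l(G)+1 & \text{if } m \text{ is odd},\\ l(G)+2 & \text{if } m \text{ is even}.\end{cases}$$
   Context: $d(u,v)$ denotes the length of a shortest path between $u$ and $v$ in $G$. Two vertices $u,v$ of a connected graph $G$ are doubly resolved by vertices $x,y$ of $G$ if $d(v,x)-d(u,x)\neq d(v,y)-d(u,y)$. A set $W\subseteq V(G)$ is a doubly resolving set for $G$ if every two distinct vertices of $G$ are doubly resolved by some two vertices of $W$. The doubly resolving number $\psi(G)$ is the minimum cardinality of a doubly resolving set for $G$. A unicyclic graph is a graph with exactly one cycle, and $C(G)$ denotes the unique cycle of a unicyclic graph $G$. A leaf is a vertex of degree $1$, and $l(G)$ denotes the number of leaves of $G$. *)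

theory Defs
  imports "Graph_Theory.Graph_Theory"
begin

text \<open>
  A finite simple graph is a \<^locale>\<open>graph\<close>: a finite loop-free digraph without multiple arcs whose
  arc relation is symmetric. Every undirected edge \<open>{u, v}\<close> is thus represented by the two arcs
  \<open>(u, v)\<close> and \<open>(v, u)\<close>.
\<close>

definition gdist :: "('a, 'b) pre_digraph \<Rightarrow> 'a \<Rightarrow> 'a \<Rightarrow> nat" where
  "gdist G u v = (LEAST n. \<exists>p. pre_digraph.apath G u p v \<and> length p = n)"

definition doubly_resolved :: "('a, 'b) pre_digraph \<Rightarrow> 'a \<Rightarrow> 'a \<Rightarrow> 'a \<Rightarrow> 'a \<Rightarrow> bool" where
  "doubly_resolved G u v x y \<longleftrightarrow>
     int (gdist G v x) - int (gdist G u x) \<noteq> int (gdist G v y) - int (gdist G u y)"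

definition doubly_resolving_set :: "('a, 'b) pre_digraph \<Rightarrow> 'a set \<Rightarrow> bool" where
  "doubly_resolving_set G W \<longleftrightarrow> W \<subseteq> verts G \<and>
     (\<forall>u\<in>verts G. \<forall>v\<in>verts G. u \<noteq> v \<longrightarrow> (\<exists>x\<in>W. \<exists>y\<in>W. doubly_resolved G u v x y))"

definition doubly_resolving_number :: "('a, 'b) pre_digraph \<Rightarrow> nat" where
  "doubly_resolving_number G = (LEAST n. \<exists>W. doubly_resolving_set G W \<and> card W = n)"

text \<open>
  The predicate \<open>pre_digraph.cycle\<close> also accepts the closed walk \<open>u, v, u\<close> along the two arcs of a
  single edge, so the length is required to be at least \<open>3\<close>. The last two conjuncts say that \<open>H\<close>
  consists of exactly the vertices and undirected edges of \<open>p\<close>, so that \<open>H\<close> does not depend on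
  the starting vertex or the direction of \<open>p\<close>.
\<close>
definition cycle_graph :: "('a, 'b) pre_digraph \<Rightarrow> bool" where
  "cycle_graph H \<longleftrightarrow> graph H \<and>
     (\<exists>p. pre_digraph.cycle H p \<and> 3 \<le> length p \<and>
          verts H = tail H ` set p \<and>
          (\<forall>e\<in>arcs H. \<exists>f\<in>set p. {tail H e, head H e} = {tail H f, head H f}))"

definition unicyclic :: "('a, 'b) pre_digraph \<Rightarrow> bool" where
  "unicyclic G \<longleftrightarrow> (\<exists>!C. subgraph C G \<and> cycle_graph C)"

definition unique_cycle :: "('a, 'b) pre_digraph \<Rightarrow> ('a, 'b) pre_digraph" where
  "unique_cycle G = (THE C. subgraph C G \<and> cycle_graph C)"

text \<open>In a symmetric digraph the out-degree of a vertex is its degree in the undirected graph.\<close>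
definition leaves :: "('a, 'b) pre_digraph \<Rightarrow> 'a set" where
  "leaves G = {v \<in> verts G. out_degree G v = 1}"

end

theory Submission
  imports Defs
begin

text \<open>
  The lower bound holds in every connected graph. If \<open>u\<close> is a leaf with neighbour \<open>v\<close>, then every
  vertex other than \<open>u\<close> is exactly one step further from \<open>u\<close> than from \<open>v\<close>; hence \<open>u\<close> and \<open>v\<close> are
  doubly resolved only with the help of \<open>u\<close> itself, and every doubly resolving set contains all leaves
  (\<open>ends_subset_resolving\<close>).

  For the upper bound, one or two cycle vertices added to the set of leaves suffice. Two observations
  carry the argument.

  \<^item> A vertex \<open>u\<close> off the cycle is the root of a branch that is joined to the rest of the graph by a
    single edge, from \<open>u\<close> to its parent; otherwise there would be a second cycle, one through \<open>u\<close>. The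
    branch contains a leaf \<open>x\<close>. For a vertex \<open>v\<close> outside the branch, \<open>u\<close> lies on every shortest path
    from \<open>v\<close> to \<open>x\<close>, but on no shortest path from \<open>v\<close> to a cycle vertex \<open>y\<close>. So \<open>x\<close> and \<open>y\<close> doubly
    resolve \<open>u\<close> and \<open>v\<close> (\<open>resolved_at_branch\<close>). Of two distinct vertices that do not both lie on the
    cycle, one is off the cycle and has the other outside its branch, so all such pairs are resolved.

  \<^item> Seen from the cycle, a leaf \<open>x\<close> looks like the cycle vertex at which its tree is attached, up to a
    constant added to all distances (\<open>projection\<close>), and constants cancel in double resolution. A leaf
    exists because the graph is not a cycle. Distances along the cycle are the distances in the whole
    graph (\<open>d_cycle\<close>), so pairs of cycle vertices are a matter of cyclic arithmetic: number the cycle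
    from the vertex where \<open>x\<close> is attached. In a cycle of length \<open>2k + 1\<close> the vertices \<open>0\<close> and \<open>k\<close>
    doubly resolve everything. In a cycle of length \<open>2k\<close> they fail only for mirror pairs \<open>i\<close>,
    \<open>2k - i\<close>, which vertex \<open>1\<close> tells apart.

  All of this concerns the adjacency relation alone and is carried out for a relation \<open>E\<close> on a finite
  set \<open>V\<close>. The last part translates between arcs and adjacency; the point that needs care is that a
  cyclic list of adjacent vertices determines a cycle subgraph, so that uniqueness of the cycle
  subgraph becomes a statement about vertex lists.
\<close>

section \<open>Distance in a connected symmetric relation\<close>

locale connected_relation =
  fixes V :: "'a set" and E :: "('a \<times> 'a) set"
  assumes finite_V: "finite V"
    and E_in_V: "E \<subseteq> V \<times> V"
    and sym_E: "sym E"
    and irrefl_E: "(v, v) \<notin> E"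
    and connected_E: "\<lbrakk>u \<in> V; v \<in> V\<rbrakk> \<Longrightarrow> (u, v) \<in> E\<^sup>*"
begin

definition d :: "'a \<Rightarrow> 'a \<Rightarrow> nat" where
  "d u v = (LEAST n. (u, v) \<in> E ^^ n)"

definition resolving :: "'a set \<Rightarrow> bool" where
  "resolving W \<longleftrightarrow> W \<subseteq> V \<and> (\<forall>u\<in>V. \<forall>v\<in>V. u \<noteq> v \<longrightarrow>
     (\<exists>x\<in>W. \<exists>y\<in>W. int (d v x) - int (d u x) \<noteq> int (d v y) - int (d u y)))"

definition ends :: "'a set" where
  "ends = {v \<in> V. \<exists>!w. (v, w) \<in> E}"

lemma E_V: "(u, v) \<in> E \<Longrightarrow> u \<in> V" "(u, v) \<in> E \<Longrightarrow> v \<in> V"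
  using E_in_V by auto

lemma E_sym: "(u, v) \<in> E \<Longrightarrow> (v, u) \<in> E"
  using sym_E by (rule symD)

lemma relpow_sym: "(u, v) \<in> E ^^ n \<Longrightarrow> (v, u) \<in> E ^^ n"
proof (induction n arbitrary: v)
  case (Suc n)
  then obtain w where "(u, w) \<in> E ^^ n" "(w, v) \<in> E" by auto
  with Suc.IH have "(w, u) \<in> E ^^ n" "(v, w) \<in> E" by (auto intro: E_sym)
  then show ?case by (meson relpow_Suc_I2)
qed simp

lemma d_relpow: "\<lbrakk>u \<in> V; v \<in> V\<rbrakk> \<Longrightarrow> (u, v) \<in> E ^^ d u v"
  unfolding d_def using connected_E rtrancl_imp_relpow by (metis LeastI)

lemma d_le: "(u, v) \<in> E ^^ n \<Longrightarrow> d u v \<le> n"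
  unfolding d_def by (rule Least_le)

lemma d_self [simp]: "d u u = 0"
  using d_le[of u u 0] by simp

lemma d_eq_0_iff: "\<lbrakk>u \<in> V; v \<in> V\<rbrakk> \<Longrightarrow> d u v = 0 \<longleftrightarrow> u = v"
  using d_relpow[of u v] by auto

lemma d_sym: "d u v = d v u"
  unfolding d_def by (metis relpow_sym)

lemma d_triangle:
  assumes "u \<in> V" "v \<in> V" "w \<in> V"
  shows "d u w \<le> d u v + d v w"
  by (rule d_le) (use assms in \<open>auto simp: relpow_add intro!: relcompI d_relpow\<close>)

lemma d_edge_le: "(u, v) \<in> E \<Longrightarrow> d u v \<le> 1"
  by (rule d_le) simp

lemma d_step:
  assumes "u \<in> V" "v \<in> V" "u \<noteq> v"
  obtains z where "(u, z) \<in> E" "d u v = Suc (d z v)"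
proof -
  obtain n where n: "d u v = Suc n"
    using d_eq_0_iff[of u v] assms by (metis not0_implies_Suc)
  then obtain z where z: "(u, z) \<in> E" "(z, v) \<in> E ^^ n"
    using d_relpow[of u v] assms by (metis relpow_Suc_E2)
  have "d u v \<le> d u z + d z v"
    using assms z E_V by (intro d_triangle) auto
  then have "d u v = Suc (d z v)"
    using n d_le[OF z(2)] d_edge_le[OF z(1)] by simp
  with z show thesis by (rule_tac that)
qed

text \<open>
  A walk from \<open>D\<close> to its complement has to use the exit edge \<open>(a, b)\<close>. Following a shortest path,
  either the first step uses that edge, or it stays in \<open>D\<close> and induction applies.
\<close>
lemma d_across_exit_ge:
  assumes exit: "\<And>z y. \<lbrakk>z \<in> D; y \<notin> D; (z, y) \<in> E\<rbrakk> \<Longrightarrow> z = a \<and> y = b"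
    and "a \<in> V" "b \<in> V" "z \<in> D" "z \<in> V" "y \<in> V" "y \<notin> D"
  shows "d z a + 1 + d b y \<le> d z y"
  using \<open>z \<in> D\<close> \<open>z \<in> V\<close>
proof (induction "d z y" arbitrary: z)
  case 0
  then show ?case using assms(6,7) d_eq_0_iff by metis
next
  case (Suc n)
  have "z \<noteq> y" using Suc.prems assms by auto
  then obtain z' where z': "(z, z') \<in> E" "d z y = Suc (d z' y)"
    using d_step Suc.prems assms by metis
  show ?case
  proof (cases "z' \<in> D")
    case True
    then have "d z' a + 1 + d b y \<le> d z' y"
      using Suc.hyps z' E_V by auto
    moreover have "d z a \<le> d z z' + d z' a"
      using z' E_V assms by (intro d_triangle) auto
    ultimately show ?thesis using z' d_edge_le[OF z'(1)] by simp
  next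
    case False
    then have "z = a" "z' = b" using exit z' Suc.prems by auto
    then show ?thesis using z' by simp
  qed
qed

lemma d_across_exit:
  assumes exit: "\<And>z y. \<lbrakk>z \<in> D; y \<notin> D; (z, y) \<in> E\<rbrakk> \<Longrightarrow> z = a \<and> y = b"
    and "(a, b) \<in> E" "z \<in> D" "z \<in> V" "y \<in> V" "y \<notin> D"
  shows "d z y = d z a + 1 + d b y"
proof -
  have V: "a \<in> V" "b \<in> V" using assms E_V by auto
  have "d z y \<le> d z a + d a y" "d a y \<le> d a b + d b y"
    using V assms by (auto intro: d_triangle)
  then show ?thesis
    using d_across_exit_ge[of D a b z y, OF exit] V assms d_edge_le[of a b] by fastforce
qed

text \<open>
  A leaf \<open>u\<close> and its neighbour \<open>v\<close> have the constant distance difference \<open>1\<close> to all vertices except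
  \<open>u\<close>, so no resolving set can omit \<open>u\<close>.
\<close>
lemma ends_subset_resolving:
  assumes "resolving W"
  shows "ends \<subseteq> W"
proof
  fix u assume "u \<in> ends"
  then obtain v where u: "u \<in> V" and v: "(u, v) \<in> E" and only: "\<And>w. (u, w) \<in> E \<Longrightarrow> w = v"
    unfolding ends_def by blast
  show "u \<in> W"
  proof (rule ccontr)
    assume "u \<notin> W"
    have eq: "d u x = Suc (d v x)" if "x \<in> W" for x
    proof -
      have "x \<in> V" "x \<noteq> u" using that assms \<open>u \<notin> W\<close> unfolding resolving_def by auto
      then show ?thesis using d_step[OF u] only by metis
    qed
    have "u \<noteq> v" "v \<in> V" using v irrefl_E E_V by auto
    then obtain x y where "x \<in> W" "y \<in> W"
      "int (d v x) - int (d u x) \<noteq> int (d v y) - int (d u y)"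
      using assms u unfolding resolving_def by blast
    then show False using eq by simp
  qed
qed

end

section \<open>Cycles as vertex lists\<close>

text \<open>
  The length bound excludes the list \<open>[u, v]\<close> of the two ends of an edge, for which all other
  conditions hold when the relation is symmetric.
\<close>
definition cycle_list :: "('a \<times> 'a) set \<Rightarrow> 'a list \<Rightarrow> bool" where
  "cycle_list E vs \<longleftrightarrow> 3 \<le> length vs \<and> distinct vs \<and>
     successively (\<lambda>x y. (x, y) \<in> E) vs \<and> (last vs, hd vs) \<in> E"

text \<open>
  Prepending a vertex that already occurs closes a detour, which is cut away.
\<close>
lemma rtrancl_imp_distinct_list:
  assumes "(p, q) \<in> R\<^sup>*"
  obtains xs where "xs \<noteq> []" "distinct xs" "successively (\<lambda>x y. (x, y) \<in> R) xs"
    "hd xs = p" "last xs = q"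
proof -
  have "\<exists>xs. xs \<noteq> [] \<and> distinct xs \<and> successively (\<lambda>x y. (x, y) \<in> R) xs \<and> hd xs = p \<and> last xs = q"
    using assms
  proof (induction rule: converse_rtrancl_induct)
    case base
    show ?case by (rule exI[of _ "[q]"]) simp
  next
    case (step y z)
    then obtain xs where xs: "xs \<noteq> []" "distinct xs" "successively (\<lambda>x y. (x, y) \<in> R) xs"
      "hd xs = z" "last xs = q" by blast
    show ?case
    proof (cases "y \<in> set xs")
      case True
      then obtain as bs where s: "xs = as @ y # bs" by (meson split_list)
      then show ?thesis
        using xs by (intro exI[of _ "y # bs"]) (auto simp: successively_append_iff)
    next
      case False
      then show ?thesis
        using xs step by (intro exI[of _ "y # xs"]) (auto simp: successively_Cons)
    qed
  qed
  then show thesis using that by blast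
qed

lemma successively_imp_rtrancl_hd:
  "\<lbrakk>successively (\<lambda>x y. (x, y) \<in> R) xs; x \<in> set xs\<rbrakk> \<Longrightarrow> (hd xs, x) \<in> R\<^sup>*"
proof (induction xs)
  case (Cons a xs)
  then show ?case
    by (cases "xs = []") (auto simp: successively_Cons intro: converse_rtrancl_into_rtrancl)
qed simp

lemma successively_imp_relpow:
  assumes "successively (\<lambda>x y. (x, y) \<in> R) xs" "i + k < length xs"
  shows "(xs ! i, xs ! (i + k)) \<in> R ^^ k"
  using assms(2)
proof (induction k)
  case (Suc k)
  then have "(xs ! (i + k), xs ! Suc (i + k)) \<in> R"
    using assms(1) by (auto simp: successively_conv_nth)
  then show ?case using Suc by auto
qed simp

lemma cycle_list_rotate1:
  assumes "cycle_list E vs"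
  shows "cycle_list E (rotate1 vs)"
proof -
  obtain x y ys where "vs = x # y # ys"
    using assms unfolding cycle_list_def by (cases vs rule: remdups_adj.cases) auto
  then show ?thesis
    using assms unfolding cycle_list_def
    using successively_append_iff[of "\<lambda>x y. (x, y) \<in> E" "y # ys" "[x]"] by auto
qed

text \<open>
  Rotation is needed to number the cycle from a prescribed vertex.
\<close>
lemma cycle_list_rotate: "cycle_list E vs \<Longrightarrow> cycle_list E (rotate n vs)"
  by (induction n) (auto intro: cycle_list_rotate1)

text \<open>
  This is the length of the shorter arc between positions \<open>i\<close> and \<open>j\<close> on a cycle of length \<open>m\<close>.
\<close>
definition cyclic_dist :: "nat \<Rightarrow> nat \<Rightarrow> nat \<Rightarrow> nat" where
  "cyclic_dist m i j = (if i \<le> j then min (j - i) (m - (j - i)) else min (i - j) (m - (i - j)))"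

text \<open>
  The difference of the distances from \<open>i\<close> to \<open>0\<close> and to \<open>k\<close> is \<open>2i - k\<close> on one arc and \<open>3k + 1 - 2i\<close>
  on the other. It is injective on each arc, and the two formulas have different parity.
\<close>
lemma cyclic_dist_resolve_odd:
  assumes m: "m = 2 * k + 1" and ij: "i < m" "j < m" "i \<noteq> j"
  shows "int (cyclic_dist m i 0) - int (cyclic_dist m j 0) \<noteq>
         int (cyclic_dist m i k) - int (cyclic_dist m j k)"
proof -
  have "int (cyclic_dist m i 0) - int (cyclic_dist m i k) =
      (if i \<le> k then 2 * int i - int k else 3 * int k + 1 - 2 * int i)" if "i < m" for i
    using that m unfolding cyclic_dist_def min_def by auto
  note this[OF ij(1)] this[OF ij(2)]
  moreover have "2 * int i - int k \<noteq> 3 * int k + 1 - 2 * int j"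
    "2 * int j - int k \<noteq> 3 * int k + 1 - 2 * int i" by presburger+
  ultimately show ?thesis using ij(3) by (auto split: if_splits)
qed

text \<open>
  In even length the two formulas are \<open>2i - k\<close> and \<open>3k - 2i\<close>, which agree exactly for \<open>i\<close> and its
  mirror image \<open>2k - i\<close>. These are equally far from \<open>0\<close>, while \<open>1\<close> is closer to the one on its own
  side.
\<close>
lemma cyclic_dist_resolve_even:
  assumes m: "m = 2 * k" and "i < m" "j < m" "i \<noteq> j"
  shows "int (cyclic_dist m i 0) - int (cyclic_dist m j 0) \<noteq>
         int (cyclic_dist m i k) - int (cyclic_dist m j k) \<or>
         int (cyclic_dist m i 0) - int (cyclic_dist m j 0) \<noteq>
         int (cyclic_dist m i 1) - int (cyclic_dist m j 1)"
proof -
  have diff: "int (cyclic_dist m i 0) - int (cyclic_dist m i k) =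
      (if i \<le> k then 2 * int i - int k else 3 * int k - 2 * int i)" if "i < m" for i
    using that m unfolding cyclic_dist_def min_def by auto
  have mirror: "int (cyclic_dist m i 0) - int (cyclic_dist m i 1) \<noteq>
      int (cyclic_dist m j 0) - int (cyclic_dist m j 1)"
    if "i \<le> k" "k < j" "j < m" "i + j = m" for i j
  proof -
    have "cyclic_dist m i 0 = cyclic_dist m j 0" "cyclic_dist m i 1 = i - 1" "1 \<le> i"
      "cyclic_dist m j 1 = min (j - 1) (i + 1)" "i < j"
      using that m unfolding cyclic_dist_def min_def by auto
    then show ?thesis by (simp add: min_def)
  qed
  show ?thesis
  proof (rule ccontr)
    assume neg: "\<not> ?thesis"
    then have eqs: "int (cyclic_dist m i 0) - int (cyclic_dist m i k) =
        int (cyclic_dist m j 0) - int (cyclic_dist m j k)"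
        "int (cyclic_dist m i 0) - int (cyclic_dist m i 1) =
        int (cyclic_dist m j 0) - int (cyclic_dist m j 1)" by linarith+
    have "i \<le> k \<and> k < j \<and> i + j = m \<or> j \<le> k \<and> k < i \<and> j + i = m"
      using eqs(1) diff[OF assms(2)] diff[OF assms(3)] m \<open>i \<noteq> j\<close> by (simp split: if_splits)
    then show False using mirror[of i j] mirror[of j i] eqs(2) assms(2,3) by metis
  qed
qed

section \<open>Unicyclic relations\<close>

text \<open>
  Uniqueness is required only of the vertex set of a cycle. Together with \<open>length_cycle\<close> this already
  excludes chords, since a chord would cut off a shorter cycle.
\<close>
locale unicyclic_relation = connected_relation +
  fixes C :: "'a set"
  assumes has_cycle: "\<exists>vs. cycle_list E vs \<and> set vs = C"
    and cycle_unique: "cycle_list E vs \<Longrightarrow> set vs = C"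
begin

lemma C_subset_V: "C \<subseteq> V"
proof -
  obtain vs where vs: "cycle_list E vs" "set vs = C" using has_cycle by blast
  have "x \<in> V" if x: "x \<in> set vs" for x
  proof -
    have "hd vs \<in> V" using vs unfolding cycle_list_def by (auto dest: E_V)
    moreover have "(hd vs, x) \<in> E\<^sup>*"
      using successively_imp_rtrancl_hd vs x unfolding cycle_list_def by metis
    ultimately show ?thesis by (metis E_V(2) rtranclE)
  qed
  then show ?thesis using vs by blast
qed

lemma C_V: "c \<in> C \<Longrightarrow> c \<in> V"
  using C_subset_V by auto

lemma finite_C: "finite C"
  using finite_subset[OF C_subset_V finite_V] .

lemma C_nonempty: "C \<noteq> {}"
  using has_cycle unfolding cycle_list_def by force

lemma length_cycle: "cycle_list E vs \<Longrightarrow> length vs = card C"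
  using cycle_unique[of vs] unfolding cycle_list_def by (metis distinct_card)

definition height :: "'a \<Rightarrow> nat" where
  "height w = Min (d w ` C)"

lemma height_le: "c \<in> C \<Longrightarrow> height w \<le> d w c"
  unfolding height_def using finite_C by simp

lemma height_attained: obtains c where "c \<in> C" "height w = d w c"
proof -
  have "height w \<in> d w ` C"
    unfolding height_def using finite_C C_nonempty by (intro Min_in) auto
  then show thesis using that by auto
qed

lemma height_eq_0_iff:
  assumes "w \<in> V"
  shows "height w = 0 \<longleftrightarrow> w \<in> C"
proof
  assume "height w = 0"
  with height_attained[of w] obtain c where "c \<in> C" "d w c = 0" by metis
  then show "w \<in> C" using d_eq_0_iff assms C_V by auto
next
  assume "w \<in> C"
  then show "height w = 0" using height_le[of w w] by simp
qed

lemma height_edge: assumes "(u, v) \<in> E" shows "height u \<le> Suc (height v)"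
proof -
  obtain c where c: "c \<in> C" "height v = d v c" by (rule height_attained)
  have "height u \<le> d u c" using c by (simp add: height_le)
  also have "\<dots> \<le> d u v + d v c" using assms E_V c C_V by (intro d_triangle) auto
  also have "\<dots> \<le> Suc (height v)" using c d_edge_le[OF assms] by simp
  finally show ?thesis .
qed

lemma height_descent:
  assumes "w \<in> V" "w \<notin> C"
  obtains p where "(w, p) \<in> E" "height w = Suc (height p)"
proof -
  obtain c where c: "c \<in> C" "height w = d w c" by (rule height_attained)
  then obtain p where p: "(w, p) \<in> E" "d w c = Suc (d p c)"
    using d_step[of w c] assms C_V by metis
  then show thesis
    using that[of p] c height_le[of c p] height_edge[of w p] by simp
qed

text \<open>
  Connectedness in \<open>avoiding w\<close> is connectedness in the graph with \<open>w\<close> deleted.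
\<close>
definition avoiding :: "'a \<Rightarrow> ('a \<times> 'a) set" where
  "avoiding w = {(x, y) \<in> E. x \<noteq> w \<and> y \<noteq> w}"

lemma avoiding_rtrancl_sym: "(x, y) \<in> (avoiding w)\<^sup>* \<Longrightarrow> (y, x) \<in> (avoiding w)\<^sup>*"
  by (metis (mono_tags, lifting) E_sym avoiding_def case_prodD case_prodI mem_Collect_eq symD symI sym_rtrancl)

text \<open>
  A vertex off the cycle separates any two of its neighbours, because a path between them that avoids
  \<open>w\<close> closes up through \<open>w\<close> to a second cycle.
\<close>
lemma neighbours_separated:
  assumes w: "w \<notin> C" and e: "(w, p) \<in> E" "(w, q) \<in> E" "p \<noteq> q"
  shows "(p, q) \<notin> (avoiding w)\<^sup>*"
proof
  assume "(p, q) \<in> (avoiding w)\<^sup>*"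
  then obtain xs where xs: "xs \<noteq> []" "distinct xs" "successively (\<lambda>x y. (x, y) \<in> avoiding w) xs"
    "hd xs = p" "last xs = q" by (rule rtrancl_imp_distinct_list)
  have "p \<noteq> w" using e irrefl_E by auto
  have "w \<notin> set xs"
  proof
    assume "w \<in> set xs"
    then have "(p, w) \<in> (avoiding w)\<^sup>*" using successively_imp_rtrancl_hd xs by metis
    then show False using \<open>p \<noteq> w\<close> by (cases rule: rtranclE) (auto simp: avoiding_def)
  qed
  moreover have "successively (\<lambda>x y. (x, y) \<in> E) xs"
    using xs(3) by (rule successively_mono) (auto simp: avoiding_def)
  moreover have "2 \<le> length xs"
    using xs e(3) by (cases xs rule: remdups_adj.cases) auto
  ultimately have "cycle_list E (w # xs)"
    using xs e E_sym unfolding cycle_list_def by (auto simp: successively_Cons)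
  then show False using cycle_unique w by fastforce
qed

text \<open>
  From a vertex that is at least as close to the cycle as \<open>w\<close>, a shortest path to the cycle has
  strictly decreasing height and therefore never meets \<open>w\<close>.
\<close>
lemma descend_avoiding:
  assumes "w \<in> V" "w \<notin> C" "q \<in> V" "q \<noteq> w" "height q \<le> height w"
  shows "\<exists>c\<in>C. (q, c) \<in> (avoiding w)\<^sup>*"
  using assms(3-)
proof (induction "height q" arbitrary: q)
  case 0
  then show ?case using height_eq_0_iff by auto
next
  case (Suc n)
  then have "q \<notin> C" using height_eq_0_iff by fastforce
  then obtain p where p: "(q, p) \<in> E" "height q = Suc (height p)"
    using height_descent Suc.prems by metis
  then have "p \<noteq> w" using Suc by auto
  then obtain c where "c \<in> C" "(p, c) \<in> (avoiding w)\<^sup>*"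
    using Suc.hyps(1)[of p] Suc.hyps(2) Suc.prems p E_V by auto
  moreover have "(q, p) \<in> avoiding w"
    using p \<open>p \<noteq> w\<close> Suc.prems by (auto simp: avoiding_def)
  ultimately show ?case by (meson converse_rtrancl_into_rtrancl)
qed

lemma C_connected_avoiding:
  assumes w: "w \<notin> C" and "c \<in> C" "c' \<in> C"
  shows "(c, c') \<in> (avoiding w)\<^sup>*"
proof -
  obtain vs where vs: "cycle_list E vs" "set vs = C" using has_cycle by blast
  have "successively (\<lambda>x y. (x, y) \<in> avoiding w) vs"
    using vs w unfolding cycle_list_def avoiding_def
    by (auto simp: successively_conv_nth)
  then have "(hd vs, x) \<in> (avoiding w)\<^sup>*" if "x \<in> C" for x
    using that vs successively_imp_rtrancl_hd by metis
  then show ?thesis using assms avoiding_rtrancl_sym by (meson rtrancl_trans)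
qed

text \<open>
  Two neighbours of \<open>w\<close> that are no higher than \<open>w\<close> would be joined without \<open>w\<close>: each descends to the
  cycle, and the cycle is connected. This is where uniqueness of the cycle turns the part off the cycle
  into a forest.
\<close>
lemma unique_lower_neighbour:
  assumes w: "w \<in> V" "w \<notin> C" and p: "(w, p) \<in> E" "height p \<le> height w"
    and q: "(w, q) \<in> E" "height q \<le> height w"
  shows "p = q"
proof (rule ccontr)
  assume "p \<noteq> q"
  have pq: "p \<in> V" "p \<noteq> w" "q \<in> V" "q \<noteq> w"
    using p q E_V irrefl_E by auto
  obtain c where c: "c \<in> C" "(p, c) \<in> (avoiding w)\<^sup>*"
    using descend_avoiding[OF w pq(1,2) p(2)] by blast
  obtain c' where c': "c' \<in> C" "(q, c') \<in> (avoiding w)\<^sup>*"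
    using descend_avoiding[OF w pq(3,4) q(2)] by blast
  have "(p, q) \<in> (avoiding w)\<^sup>*"
    using c c' C_connected_avoiding[OF w(2)] avoiding_rtrancl_sym by (meson rtrancl_trans)
  then show False using neighbours_separated w p q \<open>p \<noteq> q\<close> by blast
qed

definition parent :: "'a \<Rightarrow> 'a" where
  "parent w = (SOME p. (w, p) \<in> E \<and> height w = Suc (height p))"

lemma parent:
  assumes "w \<in> V" "w \<notin> C"
  shows "(w, parent w) \<in> E" "height w = Suc (height (parent w))"
proof -
  have "\<exists>p. (w, p) \<in> E \<and> height w = Suc (height p)"
    using height_descent assms by metis
  from someI_ex[OF this] show "(w, parent w) \<in> E" "height w = Suc (height (parent w))"
    unfolding parent_def by blast+
qed

text \<open>
  Off the cycle, every edge leads to the parent or comes from a child, as in a rooted tree.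
\<close>
lemma neighbour_cases:
  assumes "w \<in> V" "w \<notin> C" "(w, z) \<in> E"
  obtains (up) "z = parent w"
    | (down) "z \<in> V" "z \<notin> C" "parent z = w" "height z > height w"
proof (cases "height z \<le> height w")
  case True
  then have "z = parent w"
    using unique_lower_neighbour[of w z "parent w"] parent assms by simp
  then show thesis by (rule up)
next
  case False
  have z: "z \<in> V" using assms E_V by auto
  then have "z \<notin> C" using False height_eq_0_iff by fastforce
  moreover have "parent z = w"
    using unique_lower_neighbour[of z w "parent z"] parent[of z] False z \<open>z \<notin> C\<close> assms(3) E_sym
    by simp
  ultimately show thesis using down False z by simp
qed

text \<open>
  The descendants of \<open>u\<close>, including \<open>u\<close>. No parent step starts on the cycle, so a branch rooted off
  the cycle never meets it.
\<close>
definition branch :: "'a \<Rightarrow> 'a set" where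
  "branch u = {w. (w, u) \<in> {(w, parent w) | w. w \<in> V - C}\<^sup>*}"

lemma self_in_branch: "u \<in> branch u"
  unfolding branch_def by simp

lemma child_in_branch: "\<lbrakk>z \<in> V; z \<notin> C; parent z \<in> branch u\<rbrakk> \<Longrightarrow> z \<in> branch u"
  unfolding branch_def by (auto intro: converse_rtrancl_into_rtrancl)

lemma branch_cases:
  assumes "z \<in> branch u"
  shows "z = u \<or> z \<in> V \<and> z \<notin> C \<and> parent z \<in> branch u"
  using assms unfolding branch_def by (auto elim: converse_rtranclE)

lemma height_in_branch:
  assumes "z \<in> branch u"
  shows "z = u \<or> height u < height z"
proof -
  have "(z, u) \<in> {(w, parent w) | w. w \<in> V - C}\<^sup>*" using assms unfolding branch_def by simp
  then show ?thesis
  proof (induction rule: converse_rtrancl_induct)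
    case (step y z)
    then have "height y = Suc (height z)" using parent(2)[of y] by auto
    then show ?case using step by auto
  qed simp
qed

lemma branch_off_cycle:
  assumes "u \<in> V" "u \<notin> C"
  shows "branch u \<subseteq> V - C"
  using branch_cases assms by blast

lemma branch_antisym: "\<lbrakk>v \<in> branch u; u \<in> branch v\<rbrakk> \<Longrightarrow> u = v"
  using height_in_branch[of v u] height_in_branch[of u v] by auto

lemma branch_exit:
  assumes u: "u \<in> V" "u \<notin> C" and "z \<in> branch u" "y \<notin> branch u" "(z, y) \<in> E"
  shows "z = u \<and> y = parent u"
proof -
  have z: "z \<in> V" "z \<notin> C" using branch_off_cycle assms by auto
  from z \<open>(z, y) \<in> E\<close> show ?thesis
  proof (cases rule: neighbour_cases)
    case up
    then show ?thesis using branch_cases assms by blast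
  next
    case down
    then show ?thesis using child_in_branch assms by blast
  qed
qed

lemma d_leaving_branch:
  assumes "u \<in> V" "u \<notin> C" "z \<in> branch u" "y \<in> V" "y \<notin> branch u"
  shows "d z y = d z u + 1 + d (parent u) y"
proof (rule d_across_exit[where D = "branch u"])
  show "z \<in> V" using assms branch_off_cycle by auto
qed (use assms branch_exit parent in auto)

text \<open>
  A highest vertex of the branch has no child, and by \<open>neighbour_cases\<close> its parent is then its only
  neighbour.
\<close>
lemma branch_has_end:
  assumes u: "u \<in> V" "u \<notin> C"
  shows "\<exists>x\<in>branch u. x \<in> ends"
proof -
  have fin: "finite (branch u)"
    using finite_subset[OF branch_off_cycle[OF u]] finite_V by simp
  then have "Max (height ` branch u) \<in> height ` branch u"
    using self_in_branch by (intro Max_in) auto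
  then obtain x where x: "x \<in> branch u" "height x = Max (height ` branch u)" by force
  then have xV: "x \<in> V" "x \<notin> C" using branch_off_cycle u by auto
  have "z = parent x" if "(x, z) \<in> E" for z
    using xV that
  proof (cases rule: neighbour_cases)
    case down
    then have "z \<in> branch u" using x child_in_branch by simp
    then have "height z \<le> height x" using x fin by simp
    with down show ?thesis by simp
  qed
  then show ?thesis using x xV parent(1)[OF xV] unfolding ends_def by blast
qed

text \<open>
  The witness \<open>c\<close> is the cycle vertex reached by iterating the parent map, and \<open>k\<close> is the number of
  steps: each step leaves a branch through its only exit.
\<close>
lemma projection:
  assumes "x \<in> V"
  obtains c k where "c \<in> C" "\<And>c'. c' \<in> C \<Longrightarrow> d x c' = k + d c c'"
proof -
  have "\<exists>c\<in>C. \<exists>k. \<forall>c'\<in>C. d x c' = k + d c c'"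
    using assms
  proof (induction "height x" arbitrary: x)
    case 0
    then show ?case using height_eq_0_iff by (metis add_0)
  next
    case (Suc n)
    then have x: "x \<in> V" "x \<notin> C" using height_eq_0_iff by fastforce+
    then have "n = height (parent x)" "parent x \<in> V"
      using Suc.hyps(2) parent[of x] E_V by auto
    then obtain c k where c: "c \<in> C" "\<forall>c'\<in>C. d (parent x) c' = k + d c c'"
      using Suc.hyps(1) by blast
    have "d x c' = Suc k + d c c'" if "c' \<in> C" for c'
    proof -
      have "c' \<notin> branch x" using branch_off_cycle x that by auto
      then show ?thesis
        using d_leaving_branch[of x x c'] x c that C_V self_in_branch by auto
    qed
    then show ?case using c by blast
  qed
  then show thesis using that by blast
qed


text \<open>
  A chord from position \<open>i\<close> to position \<open>j\<close> closes the segment between them to a cycle with fewer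
  vertices.
\<close>
lemma cycle_chordless:
  assumes vs: "cycle_list E vs" and ij: "i < j" "j < length vs" and e: "(vs ! i, vs ! j) \<in> E"
  shows "j = Suc i \<or> (i = 0 \<and> Suc j = length vs)"
proof (rule ccontr)
  assume neg: "\<not> ?thesis"
  define ws where "ws = drop i (take (Suc j) vs)"
  have len: "length ws = Suc j - i" using ij by (simp add: ws_def)
  have "successively (\<lambda>x y. (x, y) \<in> E) ws"
    using vs unfolding cycle_list_def ws_def
    using successively_append_iff[of "\<lambda>x y. (x, y) \<in> E"] append_take_drop_id by metis
  moreover have "hd ws = vs ! i" "last ws = vs ! j"
    using ij len by (auto simp: ws_def hd_drop_conv_nth last_drop last_conv_nth)
  ultimately have "cycle_list E ws"
    using vs neg ij len e E_sym unfolding cycle_list_def by (auto simp: ws_def)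
  then have "length ws = length vs" using length_cycle vs by metis
  then show False using len neg ij by auto
qed

text \<open>
  For the lower bound, the next vertex \<open>z\<close> on a shortest path is again on the cycle: otherwise the way
  back from the branch of \<open>z\<close> leads through the vertex just left. As there are no chords, each step
  of the path moves to a neighbouring position and changes the cyclic distance by at most one.
\<close>
lemma d_cycle:
  assumes vs: "cycle_list E vs" and "i < length vs" "j < length vs"
  shows "d (vs ! i) (vs ! j) = cyclic_dist (length vs) i j"
proof (rule antisym)
  let ?m = "length vs"
  have nC: "vs ! i \<in> C" if "i < ?m" for i using cycle_unique[OF vs] that by auto
  have ne: "vs \<noteq> []" using vs unfolding cycle_list_def by auto
  have succ: "successively (\<lambda>x y. (x, y) \<in> E) vs" and closing: "(vs ! (?m - 1), vs ! 0) \<in> E"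
    using vs unfolding cycle_list_def last_conv_nth[OF ne] hd_conv_nth[OF ne] by simp_all
  have upper: "d (vs ! i) (vs ! j) \<le> cyclic_dist ?m i j" if "i \<le> j" "j < ?m" for i j
  proof -
    have "d (vs ! i) (vs ! j) \<le> j - i"
      using successively_imp_relpow[OF succ, of i "j - i"] that by (intro d_le) simp
    moreover have "(vs ! j, vs ! i) \<in> E ^^ ((?m - 1 - j) + (1 + i))"
      unfolding relpow_add
    proof (intro relcompI)
      show "(vs ! j, vs ! (?m - 1)) \<in> E ^^ (?m - 1 - j)"
        using successively_imp_relpow[OF succ, of j "?m - 1 - j"] that by simp
      show "(vs ! (?m - 1), vs ! 0) \<in> E ^^ 1" using closing by simp
      show "(vs ! 0, vs ! i) \<in> E ^^ i"
        using successively_imp_relpow[OF succ, of 0 i] that by simp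
    qed
    then have "d (vs ! i) (vs ! j) \<le> (?m - 1 - j) + (1 + i)"
      by (subst d_sym) (rule d_le)
    ultimately show ?thesis using that by (simp add: cyclic_dist_def)
  qed
  have cyc_sym: "cyclic_dist ?m i j = cyclic_dist ?m j i" for i j
    by (auto simp: cyclic_dist_def)
  show "d (vs ! i) (vs ! j) \<le> cyclic_dist ?m i j"
    using upper[of i j] upper[of j i] assms d_sym cyc_sym by (metis nat_le_linear)
  show "cyclic_dist ?m i j \<le> d (vs ! i) (vs ! j)"
    using \<open>i < ?m\<close>
  proof (induction "d (vs ! i) (vs ! j)" arbitrary: i)
    case 0
    then have "vs ! i = vs ! j" using d_eq_0_iff nC C_V assms by metis
    then have "i = j" using 0 assms vs by (simp add: cycle_list_def nth_eq_iff_index_eq)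
    then show ?case by (simp add: cyclic_dist_def)
  next
    case (Suc n)
    have "vs ! i \<noteq> vs ! j" using Suc.hyps(2) by auto
    then obtain z where z: "(vs ! i, z) \<in> E" "d (vs ! i) (vs ! j) = Suc (d z (vs ! j))"
      using d_step Suc.prems assms nC C_V by metis
    have "z \<in> C"
    proof (rule ccontr)
      assume "z \<notin> C"
      have "z \<in> V" using z E_V by auto
      have off: "vs ! i \<notin> branch z" "vs ! j \<notin> branch z"
        using branch_off_cycle[OF \<open>z \<in> V\<close> \<open>z \<notin> C\<close>] nC assms Suc.prems by auto
      have "parent z = vs ! i"
        using branch_exit[OF \<open>z \<in> V\<close> \<open>z \<notin> C\<close> self_in_branch off(1)] z E_sym by auto
      then have "d z (vs ! j) = 1 + d (vs ! i) (vs ! j)"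
        using d_leaving_branch[OF \<open>z \<in> V\<close> \<open>z \<notin> C\<close> self_in_branch _ off(2)] nC C_V assms by simp
      with z show False by simp
    qed
    then obtain k where k: "z = vs ! k" "k < ?m"
      using cycle_unique[OF vs] by (metis in_set_conv_nth)
    have "k \<noteq> i" using z k irrefl_E by auto
    then have "k = Suc i \<or> i = Suc k \<or> (i = 0 \<and> Suc k = ?m) \<or> (k = 0 \<and> Suc i = ?m)"
      using cycle_chordless[OF vs, of i k] cycle_chordless[OF vs, of k i] z k Suc.prems E_sym
      by (metis linorder_neqE_nat)
    then have "cyclic_dist ?m i j \<le> Suc (cyclic_dist ?m k j)"
      using k Suc.prems assms(3) unfolding cyclic_dist_def min_def
      by (elim disjE) auto
    also have "\<dots> \<le> d (vs ! i) (vs ! j)"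
      using Suc.hyps z k by simp
    finally show ?case .
  qed
qed

text \<open>
  The left side equals \<open>d u v\<close>, as \<open>u\<close> lies between \<open>v\<close> and \<open>x\<close>. The right side is at most
  \<open>d u v - 2\<close>: both \<open>v\<close> and \<open>y\<close> are reached from \<open>u\<close> through its parent, so going from \<open>v\<close> to \<open>y\<close>
  by way of the parent saves the edge to \<open>u\<close> and back.
\<close>
lemma resolved_at_branch:
  assumes u: "u \<in> V" "u \<notin> C" and v: "v \<in> V" "v \<notin> branch u"
    and x: "x \<in> branch u" and y: "y \<in> V" "y \<notin> branch u"
  shows "int (d v x) - int (d u x) \<noteq> int (d v y) - int (d u y)"
proof -
  have pV: "parent u \<in> V" using parent[OF u] E_V by auto
  have "d x v = d x u + 1 + d (parent u) v" "d u v = 1 + d (parent u) v"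
      "d u y = 1 + d (parent u) y"
    using d_leaving_branch[OF u x v] d_leaving_branch[OF u self_in_branch v]
      d_leaving_branch[OF u self_in_branch y] by simp_all
  moreover have "d v y \<le> d v (parent u) + d (parent u) y"
    using pV v y by (intro d_triangle)
  ultimately show ?thesis
    using d_sym[of v x] d_sym[of u x] d_sym[of v "parent u"] by linarith
qed

text \<open>
  This reduces the construction to pairs of cycle vertices. Any other pair is resolved by a leaf of
  the branch at one of its vertices and a member of \<open>S\<close>, which lies outside every
  branch rooted off the cycle.
\<close>
lemma ends_with_cycle_vertices_resolving:
  assumes S: "S \<subseteq> C" "S \<noteq> {}"
    and on_cycle: "\<And>u v. \<lbrakk>u \<in> C; v \<in> C; u \<noteq> v\<rbrakk> \<Longrightarrow>
      \<exists>x\<in>ends \<union> S. \<exists>y\<in>ends \<union> S. int (d v x) - int (d u x) \<noteq> int (d v y) - int (d u y)"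
  shows "resolving (ends \<union> S)"
  unfolding resolving_def
proof (intro conjI ballI impI)
  show "ends \<union> S \<subseteq> V" using S C_V by (auto simp: ends_def)
  have off_cycle: "\<exists>x\<in>ends \<union> S. \<exists>y\<in>ends \<union> S.
      int (d v x) - int (d u x) \<noteq> int (d v y) - int (d u y)"
    if u: "u \<in> V" "u \<notin> C" and v: "v \<in> V" "v \<notin> branch u" for u v
  proof -
    obtain x where x: "x \<in> branch u" "x \<in> ends" using branch_has_end u by blast
    obtain y where y: "y \<in> S" using S by blast
    then have "y \<in> V" "y \<notin> branch u" using S C_V branch_off_cycle[OF u] by auto
    then show ?thesis using resolved_at_branch[OF u v x(1)] x y by blast
  qed
  fix u v assume uv: "u \<in> V" "v \<in> V" "u \<noteq> v"
  show "\<exists>x\<in>ends \<union> S. \<exists>y\<in>ends \<union> S. int (d v x) - int (d u x) \<noteq> int (d v y) - int (d u y)"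
  proof (cases "u \<in> C \<and> v \<in> C")
    case True
    then show ?thesis using on_cycle uv by blast
  next
    case False
    \<comment> \<open>Two distinct vertices cannot lie in the branches of each other.\<close>
    then consider "u \<notin> C" "v \<notin> branch u" | "v \<notin> C" "u \<notin> branch v"
      using branch_antisym[of v u] branch_off_cycle uv by blast
    then show ?thesis
    proof cases
      case 1
      then show ?thesis using off_cycle uv by blast
    next
      case 2
      then obtain x y where "x \<in> ends \<union> S" "y \<in> ends \<union> S"
        "int (d u x) - int (d v x) \<noteq> int (d u y) - int (d v y)"
        using off_cycle[of v u] uv by blast
      then show ?thesis by (intro bexI[of _ x] bexI[of _ y]) auto
    qed
  qed
qed

text \<open>
  The cycle is numbered so that some leaf \<open>x\<close> is attached at position \<open>0\<close>. For cycle vertices, \<open>x\<close>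
  then replaces position \<open>0\<close>, and only the positions \<open>k\<close> and possibly \<open>1\<close> have to be added to the
  leaves.
\<close>
lemma small_resolving_set:
  assumes "V \<noteq> C"
  obtains W where "resolving W" "card W \<le> card ends + (if odd (card C) then 1 else 2)"
proof -
  obtain u where "u \<in> V" "u \<notin> C" using assms C_subset_V by blast
  then obtain x where x: "x \<in> ends" using branch_has_end by blast
  then have "x \<in> V" by (simp add: ends_def)
  then obtain c h where c: "c \<in> C" and h: "\<And>c'. c' \<in> C \<Longrightarrow> d x c' = h + d c c'"
    using projection by metis
  obtain vs0 where vs0: "cycle_list E vs0" "set vs0 = C" using has_cycle by blast
  obtain r where r: "r < length vs0" "vs0 ! r = c" using vs0 c by (metis in_set_conv_nth)
  define vs where "vs = rotate r vs0"
  define m where "m = card C"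
  have vs: "cycle_list E vs" using vs0 cycle_list_rotate by (simp add: vs_def)
  have m: "length vs = m" "3 \<le> m" using length_cycle vs by (auto simp: m_def cycle_list_def)
  have c0: "vs ! 0 = c" using r nth_rotate[of 0 vs0 r] by (cases vs0) (auto simp: vs_def)
  have nC: "vs ! i \<in> C" if "i < m" for i using that m cycle_unique[OF vs] by auto
  have dx: "d (vs ! i) x = h + cyclic_dist m i 0" if "i < m" for i
    using h[OF nC[OF that]] d_cycle[OF vs, of i 0] d_sym[of x] d_sym[of c] c0 m that by simp
  have dc: "d (vs ! i) (vs ! j) = cyclic_dist m i j" if "i < m" "j < m" for i j
    using d_cycle[OF vs, of i j] m that by simp
  have index: "\<exists>i<m. a = vs ! i" if "a \<in> C" for a
    using that cycle_unique[OF vs] m by (metis in_set_conv_nth)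
  show thesis
  proof (cases "odd m")
    case True
    then obtain k where k: "m = 2 * k + 1" by (rule oddE)
    have "resolving (ends \<union> {vs ! k})"
    proof (rule ends_with_cycle_vertices_resolving)
      fix a b assume ab: "a \<in> C" "b \<in> C" "a \<noteq> b"
      then obtain i j where ij: "i < m" "j < m" "a = vs ! i" "b = vs ! j"
        using index by metis
      then have "int (d b x) - int (d a x) \<noteq> int (d b (vs ! k)) - int (d a (vs ! k))"
        using cyclic_dist_resolve_odd[OF k, of j i] ab(3) k by (auto simp: dx dc)
      then show "\<exists>x\<in>ends \<union> {vs ! k}. \<exists>y\<in>ends \<union> {vs ! k}.
          int (d b x) - int (d a x) \<noteq> int (d b y) - int (d a y)"
        using x by blast
    qed (use nC k in auto)
    moreover have "card (ends \<union> {vs ! k}) \<le> card ends + 1"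
      using card_Un_le[of ends "{vs ! k}"] by simp
    ultimately show thesis using that True by (simp add: m_def)
  next
    case False
    then obtain k where k: "m = 2 * k" by blast
    have "resolving (ends \<union> {vs ! k, vs ! 1})"
    proof (rule ends_with_cycle_vertices_resolving)
      fix a b assume ab: "a \<in> C" "b \<in> C" "a \<noteq> b"
      then obtain i j where ij: "i < m" "j < m" "a = vs ! i" "b = vs ! j"
        using index by metis
      then have "int (d b x) - int (d a x) \<noteq> int (d b (vs ! k)) - int (d a (vs ! k)) \<or>
          int (d b x) - int (d a x) \<noteq> int (d b (vs ! 1)) - int (d a (vs ! 1))"
        using cyclic_dist_resolve_even[OF k, of j i] ab(3) k m(2) by (auto simp: dx dc)
      then show "\<exists>x\<in>ends \<union> {vs ! k, vs ! 1}. \<exists>y\<in>ends \<union> {vs ! k, vs ! 1}.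
          int (d b x) - int (d a x) \<noteq> int (d b y) - int (d a y)"
        using x by blast
    qed (use nC k m in auto)
    moreover have "card (ends \<union> {vs ! k, vs ! 1}) \<le> card ends + 2"
      using card_Un_le[of ends "{vs ! k, vs ! 1}"] card_insert_le_m1[of 2 "{vs ! 1}" "vs ! k"] by simp
    ultimately show thesis using that False by (simp add: m_def)
  qed
qed

end

section \<open>Walks, distances and cycles in digraphs\<close>

lemma (in wf_digraph) awalk_successively:
  "awalk u p v \<Longrightarrow> successively (\<lambda>x y. (x, y) \<in> arcs_ends G) (awalk_verts u p)"
proof (induction p arbitrary: u)
  case (Cons e p)
  then have e: "e \<in> arcs G" "awalk (head G e) p v" by (auto simp: awalk_Cons_iff)
  then have "hd (awalk_verts (head G e) p) = head G e" by simp
  then show ?case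
    using Cons.IH[OF e(2)] in_arcs_imp_in_arcs_ends[OF e(1)] by (simp add: successively_Cons)
qed simp

lemma (in wf_digraph) walk_along:
  assumes "xs \<noteq> []" "set xs \<subseteq> verts G" "successively (\<lambda>x y. (x, y) \<in> arcs_ends G) xs"
  obtains p where "awalk (hd xs) p (last xs)" "awalk_verts (hd xs) p = xs"
    "map (arc_to_ends G) p = zip xs (tl xs)"
proof -
  have "\<exists>p. awalk (hd xs) p (last xs) \<and> awalk_verts (hd xs) p = xs \<and>
      map (arc_to_ends G) p = zip xs (tl xs)"
    using assms
  proof (induction xs)
    case (Cons x xs)
    show ?case
    proof (cases "xs = []")
      case True
      then show ?thesis using Cons.prems by (intro exI[of _ "[]"]) (simp add: awalk_Nil_iff)
    next
      case False
      then obtain p where p: "awalk (hd xs) p (last xs)" "awalk_verts (hd xs) p = xs"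
        "map (arc_to_ends G) p = zip xs (tl xs)"
        using Cons by (auto simp: successively_Cons)
      obtain e where e: "e \<in> arcs G" "tail G e = x" "head G e = hd xs"
        using Cons.prems False by (auto simp: successively_Cons)
      have "xs = hd xs # tl xs" using False by simp
      then have "zip (x # xs) xs = (x, hd xs) # zip xs (tl xs)" by (metis zip_Cons_Cons)
      moreover have "arc_to_ends G e = (x, hd xs)" using e by (simp add: arc_to_ends_def)
      ultimately show ?thesis
        using p e False by (intro exI[of _ "e # p"]) (simp add: awalk_Cons_iff)
    qed
  qed simp
  then show thesis using that by blast
qed

lemma (in wf_digraph) relpow_iff_awalk:
  assumes "u \<in> verts G"
  shows "(u, v) \<in> arcs_ends G ^^ n \<longleftrightarrow> (\<exists>p. awalk u p v \<and> length p = n)"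
  using assms
proof (induction n arbitrary: u)
  case 0
  then show ?case by (auto simp: awalk_Nil_iff)
next
  case (Suc n)
  have "(u, v) \<in> arcs_ends G ^^ Suc n \<longleftrightarrow> (\<exists>w. (u, w) \<in> arcs_ends G \<and> (w, v) \<in> arcs_ends G ^^ n)"
    by (meson relpow_Suc_D2 relpow_Suc_I2)
  also have "\<dots> \<longleftrightarrow> (\<exists>w. (u, w) \<in> arcs_ends G \<and> (\<exists>p. awalk w p v \<and> length p = n))"
    using Suc.IH adj_in_verts by blast
  also have "\<dots> \<longleftrightarrow> (\<exists>p. awalk u p v \<and> length p = Suc n)"
    (is "?L \<longleftrightarrow> ?R")
  proof
    assume ?L
    then obtain e p where "e \<in> arcs G" "tail G e = u" "awalk (head G e) p v" "length p = n"
      by blast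
    then show ?R by (intro exI[of _ "e # p"]) (simp add: awalk_Cons_iff)
  next
    assume ?R
    then obtain e p where "awalk u (e # p) v" "length p = n" by (auto simp: length_Suc_conv)
    then show ?L using in_arcs_imp_in_arcs_ends[of e] by (auto simp: awalk_Cons_iff)
  qed
  finally show ?case .
qed

text \<open>
  A walk of minimal length repeats no vertex, since the part between two visits of a vertex could be
  removed. So minimising over paths and over walks gives the same number.
\<close>
lemma (in wf_digraph) gdist_eq_Least_relpow:
  assumes "u \<rightarrow>\<^sup>* v"
  shows "gdist G u v = (LEAST n. (u, v) \<in> arcs_ends G ^^ n)"
proof -
  have u: "u \<in> verts G" using assms by (rule reachable_in_verts)
  define n where "n = (LEAST n. (u, v) \<in> arcs_ends G ^^ n)"
  have least: "n \<le> length q" if "awalk u q v" for q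
    unfolding n_def using that relpow_iff_awalk[OF u] by (blast intro: Least_le)
  have "(u, v) \<in> arcs_ends G ^^ n"
    unfolding n_def using assms reachable_rtranclI rtrancl_imp_relpow by (metis LeastI)
  then obtain p where p: "awalk u p v" "length p = n"
    using relpow_iff_awalk[OF u] by blast
  have "distinct (awalk_verts u p)"
  proof (rule ccontr)
    assume "\<not> distinct (awalk_verts u p)"
    then obtain q r s w where "p = q @ r @ s" "0 < length r" "awalk u q w" "awalk w s v"
      using awalk_not_distinct_decomp[OF p(1)] by blast
    then show False using least[of "q @ s"] awalk_appendI p by fastforce
  qed
  then have "(\<exists>p. apath u p v \<and> length p = n)" using p unfolding apath_def by blast
  moreover have "n \<le> k" if "\<exists>p. apath u p v \<and> length p = k" for k
    using that least unfolding apath_def by blast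
  ultimately show ?thesis
    unfolding gdist_def n_def[symmetric] by (rule Least_equality)
qed

text \<open>
  Without parallel arcs, the arcs leaving a vertex correspond to its neighbours.
\<close>
lemma (in graph) leaves_iff:
  "v \<in> leaves G \<longleftrightarrow> v \<in> verts G \<and> (\<exists>!w. (v, w) \<in> arcs_ends G)"
proof -
  have eq: "{w. (v, w) \<in> arcs_ends G} = head G ` out_arcs G v"
    by (auto simp: arcs_ends_conv)
  have "inj_on (head G) (out_arcs G v)"
    by (rule inj_onI) (auto intro: no_multi_arcs simp: arc_to_ends_def)
  then have "out_degree G v = card {w. (v, w) \<in> arcs_ends G}"
    unfolding eq out_degree_def by (simp add: card_image)
  moreover have "card A = 1 \<longleftrightarrow> (\<exists>!w. w \<in> A)" for A :: "'a set"
    unfolding One_nat_def card_1_singleton_iff by blast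
  ultimately show ?thesis by (simp add: leaves_def)
qed

text \<open>
  The pairs of consecutive entries of \<open>vs\<close>, including the closing pair from the last entry back to the
  first.
\<close>
definition cyclic_pairs :: "'a list \<Rightarrow> ('a \<times> 'a) set" where
  "cyclic_pairs vs = set (zip (vs @ [hd vs]) (tl (vs @ [hd vs])))"

text \<open>
  Both orientations of every edge are included, since a graph is a symmetric digraph.
\<close>
definition cycle_subgraph :: "('a, 'b) pre_digraph \<Rightarrow> 'a list \<Rightarrow> ('a, 'b) pre_digraph" where
  "cycle_subgraph G vs = \<lparr>verts = set vs,
     arcs = {e \<in> arcs G. arc_to_ends G e \<in> cyclic_pairs vs \<union> (cyclic_pairs vs)\<inverse>},
     tail = tail G, head = head G\<rparr>"

lemma cyclic_pairs_subset:
  assumes "vs \<noteq> []"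
  shows "cyclic_pairs vs \<subseteq> set vs \<times> set vs"
  using assms unfolding cyclic_pairs_def
  by (cases vs) (auto dest: set_zip_leftD set_zip_rightD)

lemma cyclic_pairs_Suc: "Suc i < length vs \<Longrightarrow> (vs ! i, vs ! Suc i) \<in> cyclic_pairs vs"
  unfolding cyclic_pairs_def set_zip
  by (auto simp: nth_tl nth_append intro!: exI[of _ i])

lemma cyclic_pairs_last: "vs \<noteq> [] \<Longrightarrow> (last vs, hd vs) \<in> cyclic_pairs vs"
  unfolding cyclic_pairs_def set_zip
  by (auto simp: nth_tl nth_append last_conv_nth intro!: exI[of _ "length vs - 1"])

lemma fst_cyclic_pairs: "fst ` cyclic_pairs vs = set vs"
  unfolding cyclic_pairs_def set_map[symmetric] by (simp add: map_fst_zip_take)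

lemma successively_cyclic_pairs:
  "successively (\<lambda>x y. (x, y) \<in> cyclic_pairs vs) (vs @ [hd vs])"
  unfolding cyclic_pairs_def successively_conv_nth set_zip
  by (auto simp: nth_tl)

lemma cyclic_pairs_edges:
  assumes "cycle_list E vs"
  shows "cyclic_pairs vs \<subseteq> E"
proof
  fix e assume "e \<in> cyclic_pairs vs"
  then obtain i where i: "i < length vs" "e = ((vs @ [hd vs]) ! i, (vs @ [hd vs]) ! Suc i)"
    unfolding cyclic_pairs_def set_zip by (auto simp: nth_tl)
  have "successively (\<lambda>x y. (x, y) \<in> E) (vs @ [hd vs])"
    using assms unfolding cycle_list_def by (auto simp: successively_append_iff)
  then show "e \<in> E" using i unfolding successively_conv_nth by simp
qed

context graph
begin

lemma cycle_subgraph: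
  assumes vs: "cycle_list (arcs_ends G) vs"
  shows "subgraph (cycle_subgraph G vs) G" "cycle_graph (cycle_subgraph G vs)"
proof -
  let ?H = "cycle_subgraph G vs"
  let ?xs = "vs @ [hd vs]"
  have "vs \<noteq> []" using vs unfolding cycle_list_def by auto
  then have ne: "vs \<noteq> []" "hd vs \<in> set vs" by simp_all
  have ate: "arc_to_ends ?H = arc_to_ends G"
    by (simp add: cycle_subgraph_def arc_to_ends_def fun_eq_iff)
  have "set vs \<subseteq> verts G"
  proof
    fix x assume "x \<in> set vs"
    then have "\<exists>y. (x, y) \<in> cyclic_pairs vs"
      unfolding fst_cyclic_pairs[symmetric] by auto
    then show "x \<in> verts G"
      using cyclic_pairs_edges[OF vs] adj_in_verts by blast
  qed
  interpret H: graph ?H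
  proof
    fix e assume "e \<in> arcs ?H"
    then show "tail ?H e \<in> verts ?H" "head ?H e \<in> verts ?H"
      using cyclic_pairs_subset[OF ne(1)] by (auto simp: cycle_subgraph_def arc_to_ends_def)
  next
    fix e assume "e \<in> arcs ?H"
    then show "tail ?H e \<noteq> head ?H e" using no_loops by (simp add: cycle_subgraph_def)
  next
    fix e1 e2 assume "e1 \<in> arcs ?H" "e2 \<in> arcs ?H" "arc_to_ends ?H e1 = arc_to_ends ?H e2"
    then show "e1 = e2" unfolding ate using no_multi_arcs by (simp add: cycle_subgraph_def)
  next
    show "symmetric ?H"
      unfolding symmetric_conv
    proof
      fix e assume e: "e \<in> arcs ?H"
      then obtain f where "f \<in> arcs G" "tail G e = head G f" "head G e = tail G f"
        using sym_arcs unfolding symmetric_conv cycle_subgraph_def by auto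
      then show "\<exists>f\<in>arcs ?H. tail ?H e = head ?H f \<and> head ?H e = tail ?H f"
        using e by (intro bexI[of _ f]) (auto simp: cycle_subgraph_def arc_to_ends_def)
    qed
  qed (simp_all add: cycle_subgraph_def)
  show "subgraph ?H G"
    unfolding subgraph_def compatible_def
    using \<open>set vs \<subseteq> verts G\<close> wf_digraph H.wf_digraph by (auto simp: cycle_subgraph_def)
  have pairs_H: "cyclic_pairs vs \<subseteq> arcs_ends ?H"
  proof
    fix e assume e: "e \<in> cyclic_pairs vs"
    then have "e \<in> arcs_ends G" using cyclic_pairs_edges[OF vs] by auto
    then show "e \<in> arcs_ends ?H"
      using e unfolding arcs_ends_def ate by (auto simp: cycle_subgraph_def)
  qed
  have "successively (\<lambda>x y. (x, y) \<in> arcs_ends ?H) ?xs"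
    using successively_cyclic_pairs by (rule successively_mono) (use pairs_H in auto)
  then obtain p where p: "H.awalk (hd ?xs) p (last ?xs)" "H.awalk_verts (hd ?xs) p = ?xs"
    "map (arc_to_ends ?H) p = zip ?xs (tl ?xs)"
    using H.walk_along[of ?xs] ne by (auto simp: cycle_subgraph_def)
  have len: "length p = length vs" using arg_cong[OF p(3), of length] by simp
  have pairs: "arc_to_ends ?H ` set p = cyclic_pairs vs"
    using arg_cong[OF p(3), of set] by (simp add: cyclic_pairs_def)
  show "cycle_graph ?H"
    unfolding cycle_graph_def
  proof (intro conjI exI[of _ p] ballI)
    show "graph ?H" by (rule H.graph_axioms)
    show "H.cycle p"
      unfolding H.cycle_def
    proof (intro exI[of _ "hd vs"] conjI)
      show "H.awalk (hd vs) p (hd vs)" using p(1) ne by simp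
      have "distinct (tl ?xs)" using vs ne unfolding cycle_list_def by (cases vs) auto
      then show "distinct (tl (H.awalk_verts (hd vs) p))" using p(2) ne by simp
      show "p \<noteq> []" using len ne by auto
    qed
    show "3 \<le> length p" using len vs by (simp add: cycle_list_def)
    have "map (tail ?H) p = map fst (zip ?xs (tl ?xs))"
      unfolding p(3)[symmetric] by (simp add: arc_to_ends_def)
    also have "\<dots> = vs" by (simp add: map_fst_zip_take)
    finally have "tail ?H ` set p = set vs" by (metis list.set_map)
    then show "verts ?H = tail ?H ` set p" by (simp add: cycle_subgraph_def)
    fix e assume "e \<in> arcs ?H"
    then have "(tail ?H e, head ?H e) \<in> cyclic_pairs vs \<union> (cyclic_pairs vs)\<inverse>"
      by (simp add: cycle_subgraph_def arc_to_ends_def)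
    then show "\<exists>f\<in>set p. {tail ?H e, head ?H e} = {tail ?H f, head ?H f}"
      unfolding pairs[symmetric] by (auto simp: arc_to_ends_def)
  qed
qed

text \<open>
  The vertices of a closed walk, with the start dropped because it reappears at the end.
\<close>
lemma cycle_graph_imp_cycle_list:
  assumes "subgraph C G" "cycle_graph C"
  obtains vs where "cycle_list (arcs_ends G) vs" "set vs = verts C"
proof -
  interpret C: graph C using assms unfolding cycle_graph_def by simp
  obtain p where p: "C.cycle p" "3 \<le> length p" "verts C = tail C ` set p"
    using assms unfolding cycle_graph_def by blast
  then obtain u where u: "C.awalk u p u" "distinct (tl (C.awalk_verts u p))"
    unfolding C.cycle_def by blast
  define vs where "vs = tl (C.awalk_verts u p)"
  have xs: "C.awalk_verts u p = u # vs"
    unfolding vs_def using u(1) by (metis C.awhd_of_awalk C.awalk_verts_non_Nil list.collapse)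
  have len: "length vs = length p" using C.length_awalk_verts[of u p] xs by simp
  then have ne: "vs \<noteq> []" using p by auto
  have last: "last vs = u" using C.awlast_of_awalk[OF u(1)] xs ne u(1) by auto
  have sub: "arcs_ends C \<subseteq> arcs_ends G" using assms(1) by (rule arcs_ends_mono)
  have "successively (\<lambda>x y. (x, y) \<in> arcs_ends G) (u # vs)"
    using C.awalk_successively[OF u(1)] unfolding xs
    by (rule successively_mono) (use sub in auto)
  then have "cycle_list (arcs_ends G) vs"
    using u(2) p(2) len last ne unfolding cycle_list_def
    by (auto simp: successively_Cons vs_def[symmetric])
  moreover have "set vs = verts C"
  proof -
    have "set (u # vs) \<subseteq> verts C" using u(1) unfolding xs[symmetric] by blast
    moreover have "tail C ` set p \<subseteq> set (u # vs)"
      using C.awalk_verts_arc1[of _ p u] xs by auto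
    moreover have "u \<in> set vs" using last last_in_set[OF ne] by simp
    ultimately show ?thesis using p(3) by (simp add: insert_absorb)
  qed
  ultimately show thesis by (rule that)
qed

end

theorem theorem4p5:
  fixes G :: "('a, 'b) pre_digraph" and m :: nat
  assumes "graph G"
    and "Digraph_Component.connected G"
    and "unicyclic G"
    and "\<not> cycle_graph G"
    and "m = card (verts (unique_cycle G))"
  shows "card (leaves G) \<le> doubly_resolving_number G \<and>
    doubly_resolving_number G \<le>
      (if odd m then card (leaves G) + 1 else card (leaves G) + 2)"
proof -
  interpret graph G by fact
  let ?E = "arcs_ends G"
  define C where "C = unique_cycle G"
  have C: "subgraph C G" "cycle_graph C"
    using theI'[OF assms(3)[unfolded unicyclic_def]] unfolding C_def unique_cycle_def by auto
  have unique: "H = C" if "subgraph H G" "cycle_graph H" for H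
    using assms(3) C that unfolding unicyclic_def by blast
  have reach: "u \<rightarrow>\<^sup>*\<^bsub>G\<^esub> v" if "u \<in> verts G" "v \<in> verts G" for u v
    using assms(2) that reachable_mk_symmetric_eq[OF sym_arcs]
    unfolding connected_def strongly_connected_def by simp
  interpret unicyclic_relation "verts G" ?E "verts C"
  proof
    show "finite (verts G)" by simp
    show "?E \<subseteq> verts G \<times> verts G" using adj_in_verts by auto
    show "sym ?E" using sym_arcs by (simp add: symmetric_def)
    show "(v, v) \<notin> ?E" for v using adj_not_same by blast
    show "(u, v) \<in> ?E\<^sup>*" if "u \<in> verts G" "v \<in> verts G" for u v
      using reach[OF that] by (rule reachable_rtranclI)
    show "\<exists>vs. cycle_list ?E vs \<and> set vs = verts C"
      using cycle_graph_imp_cycle_list[OF C] by blast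
    show "set vs = verts C" if "cycle_list ?E vs" for vs
      using unique[OF cycle_subgraph[OF that]] by (auto simp: cycle_subgraph_def)
  qed
  have gd: "gdist G u v = d u v" if "u \<in> verts G" "v \<in> verts G" for u v
    using gdist_eq_Least_relpow[OF reach[OF that]] by (simp add: d_def)
  have resolving_iff: "doubly_resolving_set G W \<longleftrightarrow> resolving W" for W
    unfolding doubly_resolving_set_def resolving_def doubly_resolved_def
    using gd by (intro conj_cong ball_cong refl imp_cong bex_cong) (auto simp: subset_iff)
  have leaves: "leaves G = ends"
    using leaves_iff unfolding ends_def by blast
  \<comment> \<open>If the cycle covered all vertices, then, having no chords, it would be the whole graph.\<close>
  have "verts G \<noteq> verts C"
  proof
    assume V: "verts G = verts C"
    obtain vs where vs: "cycle_list ?E vs" "set vs = verts C" using has_cycle by blast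
    have "arcs G \<subseteq> arcs (cycle_subgraph G vs)"
    proof
      fix e assume e: "e \<in> arcs G"
      then have "tail G e \<in> set vs" "head G e \<in> set vs" using wellformed[OF e] vs(2) V by simp_all
      then obtain i j where ij: "i < length vs" "j < length vs" "tail G e = vs ! i" "head G e = vs ! j"
        by (metis in_set_conv_nth)
      have E: "(vs ! i, vs ! j) \<in> ?E" using in_arcs_imp_in_arcs_ends[OF e] ij by simp
      have "i \<noteq> j" using no_loops[OF e] ij by auto
      have pair: "(vs ! i, vs ! j) \<in> cyclic_pairs vs \<union> (cyclic_pairs vs)\<inverse>"
        if "i < j" "j < length vs" "(vs ! i, vs ! j) \<in> ?E" for i j
      proof -
        have ne: "vs \<noteq> []" using that by auto
        from cycle_chordless[OF vs(1) that] show ?thesis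
        proof
          assume "j = Suc i"
          then show ?thesis using cyclic_pairs_Suc that by blast
        next
          assume "i = 0 \<and> Suc j = length vs"
          then have "i = 0" "j = length vs - 1" by auto
          then have "vs ! i = hd vs" "vs ! j = last vs"
            by (simp_all add: hd_conv_nth[OF ne] last_conv_nth[OF ne])
          then show ?thesis using cyclic_pairs_last[OF ne] by simp
        qed
      qed
      have "(vs ! i, vs ! j) \<in> cyclic_pairs vs \<union> (cyclic_pairs vs)\<inverse>"
        using pair[of i j] pair[of j i] ij E E_sym \<open>i \<noteq> j\<close> by (cases i j rule: linorder_cases) auto
      then show "e \<in> arcs (cycle_subgraph G vs)"
        using e ij by (simp add: cycle_subgraph_def arc_to_ends_def)
    qed
    then have "cycle_subgraph G vs = G"
      using vs V by (intro pre_digraph.equality) (auto simp: cycle_subgraph_def)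
    then show False using cycle_subgraph(2)[OF vs(1)] assms(4) by simp
  qed
  then obtain W where W: "resolving W"
      "card W \<le> card ends + (if odd (card (verts C)) then 1 else 2)"
    using small_resolving_set by blast
  have upper: "doubly_resolving_number G \<le> card W"
    unfolding doubly_resolving_number_def using W(1) resolving_iff by (intro Least_le) blast
  have ex: "\<exists>n W. doubly_resolving_set G W \<and> card W = n"
    using W(1) resolving_iff by blast
  have "\<exists>W. doubly_resolving_set G W \<and> card W = doubly_resolving_number G"
    using LeastI_ex[OF ex] unfolding doubly_resolving_number_def .
  then obtain W' where W': "resolving W'" "card W' = doubly_resolving_number G"
    using resolving_iff by blast
  then have "finite W'" unfolding resolving_def using finite_verts finite_subset by blast
  then have "card ends \<le> card W'" using ends_subset_resolving[OF W'(1)] by (rule card_mono)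
  then show ?thesis using upper W(2) W'(2) leaves assms(5) by (auto simp: C_def)
qed

end
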